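(* Let $f:[0,\infty)\to\mathbb{R}$ be a function that is differentiable on $(0,\infty)$, let $0<u<v$, and suppose $f'\in L[u,v]$. If $|f'|$ is $s$-convex (in the second sense) on $[u,v]$ for some fixed $s\in(0,1]$, then for each $x\in[u,v]$, $$\left|\frac{(v-x)(vf(v)-uf(x))+(x-u)(vf(x)-uf(u))}{(v-u)^2}-\frac{1}{v-u}\int_u^v f(\mu)\,d\mu\right|$$ $$\le \frac{(v-x)^2}{(v-u)^2}\left[\frac{((s+1)u+v)|f'(x)|+(u+(s+1)v)|f'(v)|}{(s+1)(s+2)}\right]+\frac{(x-u)^2}{(v-u)^2}\left[\frac{(u+(s+1)v)|f'(x)|+((s+1)u+v)|f'(u)|}{(s+1)(s+2)}\right].$$
   Context: $L[u,v]$ denotes the space of Lebesgue integrable functions on $[u,v]$. For $s\in(0,1]$, a nonnegative function $g$ on an interval $[u,v]$ is $s$-convex (in the second sense) on $[u,v]$ if $g(ty+(1-t)z)\le t^s g(y)+(1-t)^s g(z)$ for all $y,z\in[u,v]$ and $t\in[0,1]$. *)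

theory Defs
  imports "HOL-Analysis.Analysis"
begin

text \<open>
  s-convexity in the second sense (Breckner), intended for \<open>s\<close> in \<open>(0,1]\<close> and an
  interval \<open>I\<close>. Since \<open>0 powr s = 0\<close>, the cases \<open>t = 0\<close> and \<open>t = 1\<close> of the inequality
  have their usual meaning.
\<close>

definition s_convex_on :: "real \<Rightarrow> real set \<Rightarrow> (real \<Rightarrow> real) \<Rightarrow> bool" where
  "s_convex_on s I g \<longleftrightarrow>
     (\<forall>y\<in>I. 0 \<le> g y) \<and>
     (\<forall>y\<in>I. \<forall>z\<in>I. \<forall>t\<in>{0..1}.
        g (t * y + (1 - t) * z) \<le> t powr s * g y + (1 - t) powr s * g z)"

end

theory Submission
  imports Defs
begin

text \<open>
  On \<open>[0,1]\<close>, integrating the derivative of \<open>w(t) g(t)\<close> with the affine weight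
  \<open>w(t) = p (1 - t) + q t\<close> gives
  \<open>q g(1) - p g(0) - (q - p) \<integral>\<^sub>0\<^sup>1 g = \<integral>\<^sub>0\<^sup>1 w g'\<close>.
  Applied with \<open>p = u\<close>, \<open>q = v\<close> to the restrictions of \<open>f\<close> to \<open>[x,v]\<close> and to \<open>[u,x]\<close>,
  each rescaled to \<open>[0,1]\<close> and multiplied by the length of its segment over \<open>(v - u)\<^sup>2\<close>,
  the left-hand sides of this identity add up to the expression to be estimated: the factor
  \<open>q - p = v - u\<close> is the same for both segments, so the two integral terms combine to
  \<open>1 / (v - u)\<close> times the integral of \<open>f\<close> over \<open>[u,v]\<close>.

  Since \<open>w\<close> is nonnegative, the estimate follows from a pointwise bound for \<open>|g'|\<close>.
  The \<open>s\<close>-convexity supplies it, namely \<open>t\<^sup>s\<close> and \<open>(1 - t)\<^sup>s\<close> times the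
  values of \<open>|f'|\<close> at the ends of the segment, and the constants in the theorem are the
  integrals of these powers against \<open>w\<close>: \<open>\<integral>\<^sub>0\<^sup>1 t\<^sup>s w(t) dt\<close> is
  \<open>(p + (s + 1) q) / ((s + 1) (s + 2))\<close>, and the other one follows by reflection
  (lemma \<open>weighted_difference_bound_unit\<close>; \<open>weighted_difference_bound\<close> is its rescaled form).
\<close>

lemma has_integral_affine_times_powr:
  fixes p q s :: real
  assumes "0 < s"
  shows "((\<lambda>t. (p * (1 - t) + q * t) * t powr s) has_integral
           (p + (s + 1) * q) / ((s + 1) * (s + 2))) {0..1}"
proof -
  have "((\<lambda>t. p * t powr s + (q - p) * t powr (s + 1)) has_integral
          p * (1 / (s + 1)) + (q - p) * (1 / (s + 2))) {0..1}"
    using has_integral_powr_from_0[of s 1] has_integral_powr_from_0[of "s + 1" 1] assms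
    by (intro has_integral_add has_integral_mult_right) (simp_all add: add.assoc)
  moreover have "p * (1 / (s + 1)) + (q - p) * (1 / (s + 2)) = (p + (s + 1) * q) / ((s + 1) * (s + 2))"
    using assms by (simp add: divide_simps) (simp add: algebra_simps)
  moreover have "p * t powr s + (q - p) * t powr (s + 1) = (p * (1 - t) + q * t) * t powr s"
    if "t \<in> {0..1}" for t
    using that by (simp add: powr_add algebra_simps)
  ultimately show ?thesis
    by (metis (no_types, lifting) has_integral_cong)
qed

lemma has_integral_affine_times_powr_reflected:
  fixes p q s :: real
  assumes "0 < s"
  shows "((\<lambda>t. (p * (1 - t) + q * t) * (1 - t) powr s) has_integral
           ((s + 1) * p + q) / ((s + 1) * (s + 2))) {0..1}"
proof -
  have "(\<lambda>x. - x + 1) ` {0..1::real} = {0..1}"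
    by (auto simp: image_iff intro: bexI[where x = "1 - _"])
  then show ?thesis
    using has_integral_affinity[OF has_integral_affine_times_powr[OF assms, of q p, unfolded interval_cbox],
        of "-1" 1]
    by (simp add: algebra_simps)
qed

lemma weighted_difference_bound_unit:
  fixes g g' :: "real \<Rightarrow> real"
  assumes deriv: "\<And>t. t \<in> {0..1} \<Longrightarrow> (g has_real_derivative g' t) (at t within {0..1})"
    and bound: "\<And>t. t \<in> {0..1} \<Longrightarrow> \<bar>g' t\<bar> \<le> t powr s * A + (1 - t) powr s * B"
    and "0 < s" "0 \<le> p" "0 \<le> q"
  shows "\<bar>q * g 1 - p * g 0 - (q - p) * integral {0..1} g\<bar>
         \<le> ((p + (s + 1) * q) * A + ((s + 1) * p + q) * B) / ((s + 1) * (s + 2))"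
proof -
  let ?w = "\<lambda>t. p * (1 - t) + q * t"
  let ?M = "\<lambda>t. ?w t * t powr s * A + ?w t * (1 - t) powr s * B"
  have product_rule: "((\<lambda>t. (q - p) * g t + ?w t * g' t) has_integral ?w 1 * g 1 - ?w 0 * g 0) {0..1}"
  proof (rule fundamental_theorem_of_calculus)
    show "((\<lambda>t. ?w t * g t) has_vector_derivative (q - p) * g t + ?w t * g' t) (at t within {0..1})"
      if "t \<in> {0..1}" for t
    proof -
      have "(?w has_real_derivative q - p) (at t within {0..1})"
        by (auto intro!: derivative_eq_intros)
      from DERIV_mult[OF this deriv[OF that]] show ?thesis
        by (simp add: has_real_derivative_iff_has_vector_derivative mult.commute add.commute)
    qed
  qed simp
  have "g integrable_on {0..1}"
    by (intro integrable_continuous_real DERIV_continuous_on[OF deriv])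
  then have scaled: "((\<lambda>t. (q - p) * g t) has_integral (q - p) * integral {0..1} g) {0..1}"
    by (intro has_integral_mult_right integrable_integral)
  \<comment> \<open>The integrability of \<open>w g'\<close> comes out of the product rule: it is the derivative of
    \<open>w g\<close> minus a continuous function.\<close>
  have by_parts:
    "((\<lambda>t. ?w t * g' t) has_integral q * g 1 - p * g 0 - (q - p) * integral {0..1} g) {0..1}"
    using has_integral_diff[OF product_rule scaled] by simp
  have majorant: "(?M has_integral
      (p + (s + 1) * q) / ((s + 1) * (s + 2)) * A + ((s + 1) * p + q) / ((s + 1) * (s + 2)) * B) {0..1}"
    using \<open>0 < s\<close>
    by (intro has_integral_add has_integral_mult_left has_integral_affine_times_powr
        has_integral_affine_times_powr_reflected)
  have "norm (?w t * g' t) \<le> ?M t" if "t \<in> {0..1}" for t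
  proof -
    have "0 \<le> ?w t"
      using that \<open>0 \<le> p\<close> \<open>0 \<le> q\<close> by simp
    then have "norm (?w t * g' t) \<le> ?w t * (t powr s * A + (1 - t) powr s * B)"
      using bound[OF that] by (simp add: abs_mult mult_left_mono)
    then show ?thesis
      by (simp add: algebra_simps)
  qed
  then have "norm (integral {0..1} (\<lambda>t. ?w t * g' t)) \<le> integral {0..1} ?M"
    using by_parts majorant by (intro integral_norm_bound_integral) (auto simp: integrable_on_def)
  then show ?thesis
    unfolding integral_unique[OF by_parts] integral_unique[OF majorant] real_norm_def
    by (simp only: add_divide_distrib[of "_ * A" "_ * B"] times_divide_eq_left)
qed

text \<open>
  Multiplying by the length of the segment keeps the statement free of division by it, so that it
  also covers degenerate segments, which occur when \<open>x\<close> is an endpoint of \<open>[u,v]\<close>.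
\<close>

lemma weighted_difference_bound:
  fixes f f' :: "real \<Rightarrow> real"
  assumes deriv: "\<And>y. y \<in> {a..b} \<Longrightarrow> (f has_real_derivative f' y) (at y within {a..b})"
    and conv: "s_convex_on s {a..b} (\<lambda>y. \<bar>f' y\<bar>)"
    and "a \<le> b" "0 < s" "0 \<le> p" "0 \<le> q"
  shows "\<bar>(b - a) * (q * f b - p * f a) - (q - p) * integral {a..b} f\<bar>
         \<le> (b - a)\<^sup>2 * (((p + (s + 1) * q) * \<bar>f' b\<bar> + ((s + 1) * p + q) * \<bar>f' a\<bar>)
                         / ((s + 1) * (s + 2)))"
proof -
  let ?h = "\<lambda>t. t * b + (1 - t) * a"
  let ?D = "(s + 1) * (s + 2)"
  have h_mem: "?h t \<in> {a..b}" if "t \<in> {0..1}" for t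
    using convexD[OF convex_real_interval(5)[of a b], of b a t "1 - t"] that \<open>a \<le> b\<close> by simp
  have h_deriv: "(?h has_real_derivative (b - a)) (at t within {0..1})" for t
    by (auto intro!: derivative_eq_intros)
  have g_deriv: "((\<lambda>t. f (?h t)) has_real_derivative f' (?h t) * (b - a)) (at t within {0..1})"
    if "t \<in> {0..1}" for t
  proof -
    have "(f has_real_derivative f' (?h t)) (at (?h t) within ?h ` {0..1})"
      using h_mem by (intro DERIV_subset[OF deriv[OF h_mem[OF that]]]) blast
    then show ?thesis
      using DERIV_image_chain[OF _ h_deriv] by (simp add: o_def)
  qed
  have g_bound: "\<bar>f' (?h t) * (b - a)\<bar>
      \<le> t powr s * ((b - a) * \<bar>f' b\<bar>) + (1 - t) powr s * ((b - a) * \<bar>f' a\<bar>)"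
    if "t \<in> {0..1}" for t
  proof -
    have "\<bar>f' (?h t)\<bar> \<le> t powr s * \<bar>f' b\<bar> + (1 - t) powr s * \<bar>f' a\<bar>"
      using conv that \<open>a \<le> b\<close> unfolding s_convex_on_def by simp
    from mult_left_mono[OF this, of "b - a"] show ?thesis
      using \<open>a \<le> b\<close> by (simp add: abs_mult distrib_left mult_ac)
  qed
  have rescaled: "\<bar>q * f b - p * f a - (q - p) * integral {0..1} (\<lambda>t. f (?h t))\<bar>
      \<le> ((p + (s + 1) * q) * ((b - a) * \<bar>f' b\<bar>) + ((s + 1) * p + q) * ((b - a) * \<bar>f' a\<bar>)) / ?D"
    using weighted_difference_bound_unit[OF g_deriv g_bound] assms(4-6) by simp
  have "((\<lambda>t. (b - a) *\<^sub>R f (?h t)) has_integral integral {?h 0..?h 1} f) {0..1}"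
    using h_mem \<open>a \<le> b\<close>
    by (intro has_integral_substitution[where c = a and d = b] h_deriv DERIV_continuous_on[OF deriv])
       auto
  then have subst: "(b - a) * integral {0..1} (\<lambda>t. f (?h t)) = integral {a..b} f"
    by (simp add: integral_unique flip: integral_mult_right)
  have "\<bar>(b - a) * (q * f b - p * f a) - (q - p) * integral {a..b} f\<bar>
      = (b - a) * \<bar>q * f b - p * f a - (q - p) * integral {0..1} (\<lambda>t. f (?h t))\<bar>"
    using \<open>a \<le> b\<close> unfolding subst[symmetric]
    by (subst abs_of_nonneg[of "b - a", symmetric], simp)
       (simp only: abs_mult[symmetric], simp add: algebra_simps)
  also have "\<dots> \<le> (b - a) * (((p + (s + 1) * q) * ((b - a) * \<bar>f' b\<bar>)
      + ((s + 1) * p + q) * ((b - a) * \<bar>f' a\<bar>)) / ?D)"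
    using rescaled \<open>a \<le> b\<close> by (intro mult_left_mono) auto
  also have "\<dots> = (b - a)\<^sup>2 * (((p + (s + 1) * q) * \<bar>f' b\<bar> + ((s + 1) * p + q) * \<bar>f' a\<bar>) / ?D)"
    by (simp add: power2_eq_square distrib_left mult_ac)
  finally show ?thesis .
qed

lemma s_convex_on_subset:
  "s_convex_on s I g \<Longrightarrow> J \<subseteq> I \<Longrightarrow> s_convex_on s J g"
  unfolding s_convex_on_def by blast

theorem theorem4:
  fixes f :: "real \<Rightarrow> real" and u v s x :: real
  assumes "f differentiable_on {0<..}"
    and "0 < u" and "u < v"
    and "set_integrable lebesgue {u..v} (deriv f)"
    and "0 < s" and "s \<le> 1"
    and "s_convex_on s {u..v} (\<lambda>y. \<bar>deriv f y\<bar>)"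
    and "x \<in> {u..v}"
  shows "\<bar>((v - x) * (v * f v - u * f x) + (x - u) * (v * f x - u * f u)) / (v - u)\<^sup>2
            - 1 / (v - u) * (LINT \<mu>:{u..v}|lebesgue. f \<mu>)\<bar>
         \<le> (v - x)\<^sup>2 / (v - u)\<^sup>2
              * ((((s + 1) * u + v) * \<bar>deriv f x\<bar> + (u + (s + 1) * v) * \<bar>deriv f v\<bar>)
                  / ((s + 1) * (s + 2)))
           + (x - u)\<^sup>2 / (v - u)\<^sup>2
              * (((u + (s + 1) * v) * \<bar>deriv f x\<bar> + ((s + 1) * u + v) * \<bar>deriv f u\<bar>)
                  / ((s + 1) * (s + 2)))"
proof -
  have deriv: "(f has_real_derivative deriv f y) (at y within S)" if "0 < y" for y S
  proof -
    have "f differentiable (at y)"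
      using assms(1) that by (simp add: differentiable_on_eq_differentiable_at)
    then show ?thesis
      by (metis DERIV_deriv_iff_real_differentiable has_field_derivative_at_within)
  qed
  have "u \<le> x" "x \<le> v"
    using assms(8) by auto
  let ?I = "\<lambda>a b. integral {a..b} f"
  let ?bound = "\<lambda>a b. (b - a)\<^sup>2 * (((u + (s + 1) * v) * \<bar>deriv f b\<bar>
      + ((s + 1) * u + v) * \<bar>deriv f a\<bar>) / ((s + 1) * (s + 2)))"
  have segment: "\<bar>(b - a) * (v * f b - u * f a) - (v - u) * ?I a b\<bar> \<le> ?bound a b"
    if "u \<le> a" "a \<le> b" "b \<le> v" for a b
    using that assms(2,3,5)
    by (intro weighted_difference_bound deriv s_convex_on_subset[OF assms(7)]) auto
  have cont: "continuous_on {u..v} f"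
    using assms(2) by (intro DERIV_continuous_on[of _ f "deriv f"] deriv) auto
  have "(LINT \<mu>:{u..v}|lebesgue. f \<mu>) = ?I u v"
    using cont by (intro set_lebesgue_integral_eq_integral(2) absolutely_integrable_continuous_real)
  also have "\<dots> = ?I u x + ?I x v"
    using \<open>u \<le> x\<close> \<open>x \<le> v\<close> integrable_continuous_real[OF cont]
    by (simp add: Henstock_Kurzweil_Integration.integral_combine)
  finally have split: "(LINT \<mu>:{u..v}|lebesgue. f \<mu>) = ?I u x + ?I x v" .
  have "((v - x) * (v * f v - u * f x) + (x - u) * (v * f x - u * f u)) / (v - u)\<^sup>2
            - 1 / (v - u) * (LINT \<mu>:{u..v}|lebesgue. f \<mu>)
      = (((v - x) * (v * f v - u * f x) - (v - u) * ?I x v)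
          + ((x - u) * (v * f x - u * f u) - (v - u) * ?I u x)) / (v - u)\<^sup>2"
    unfolding split using assms(3)
    by (simp add: divide_simps power2_eq_square) (simp add: algebra_simps)
  then have "\<bar>((v - x) * (v * f v - u * f x) + (x - u) * (v * f x - u * f u)) / (v - u)\<^sup>2
            - 1 / (v - u) * (LINT \<mu>:{u..v}|lebesgue. f \<mu>)\<bar>
      = \<bar>((v - x) * (v * f v - u * f x) - (v - u) * ?I x v)
          + ((x - u) * (v * f x - u * f u) - (v - u) * ?I u x)\<bar> / (v - u)\<^sup>2"
    by simp
  also have "\<dots> \<le> (?bound x v + ?bound u x) / (v - u)\<^sup>2"
    using segment[of x v] segment[of u x] \<open>u \<le> x\<close> \<open>x \<le> v\<close>
    by (intro divide_right_mono abs_triangle_ineq[THEN order_trans] add_mono) auto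
  finally show ?thesis
    by (simp add: add_divide_distrib add.commute)
qed

end
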